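(* Let $f:\mathbf E\to\mathbb R$ be convex and smooth, let $g:\mathbf E\to\mathbb R$ be non-negative, strongly convex and smooth, and let $r\in\mathbb R$. Assume that $$\min_{x\in\mathbf E}f(x)<\min_{x\in\mathbf E:\,g(x)\leq r}f(x)$$ and that there exists $x_0\in\mathbf E$ with $g(x_0)<r$. Then the problem $\min_{g(x)\leq r}f(x)$ satisfies the Hölderian error bound condition with $\theta=1/2$; that is, with $\Omega=\{x\in\mathbf E:g(x)\leq r\}$, $f_*=\min_{x\in\Omega}f(x)$ and $\Omega_*=\arg\min_{x\in\Omega}f(x)$, there exists a constant $0<c<\infty$ such that for every $x\in\Omega$, $$\min_{w\in\Omega_*}\|x-w\|\leq c\,(f(x)-f_* )^{1/2}.$$
   Context: $\mathbf E$ is a finite-dimensional real vector space with a norm $\|\cdot\|$. Smooth means differentiable with Lipschitz continuous gradient, and strongly convex means strongly convex with some positive modulus with respect to $\|\cdot\|$. Writing $\min_{x\in\mathbf E}f(x)$ presupposes that the minimum is attained. *)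

theory Defs
  imports "HOL-Analysis.Analysis"
begin

definition argmin_set :: "('a \<Rightarrow> real) \<Rightarrow> 'a set \<Rightarrow> 'a set" where
  "argmin_set h S = {x. is_arg_min h (\<lambda>y. y \<in> S) x}"

definition min_attained :: "('a \<Rightarrow> real) \<Rightarrow> 'a set \<Rightarrow> bool" where
  "min_attained h S \<longleftrightarrow> argmin_set h S \<noteq> {}"

(* An unspecified real number unless min_attained h S holds. *)
definition min_value :: "('a \<Rightarrow> real) \<Rightarrow> 'a set \<Rightarrow> real" where
  "min_value h S = (LEAST m. m \<in> h ` S)"

(* The gradient is the Frechet derivative, an element of the dual space;
   its Lipschitz continuity is with respect to the dual (operator) norm. *)
definition smooth_fun :: "('a::real_normed_vector \<Rightarrow> real) \<Rightarrow> bool" where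
  "smooth_fun h \<longleftrightarrow> (\<exists>(h' :: 'a \<Rightarrow> 'a \<Rightarrow>\<^sub>L real) L.
     (\<forall>x. (h has_derivative blinfun_apply (h' x)) (at x)) \<and> L-lipschitz_on UNIV h')"

definition strongly_convex :: "('a::real_normed_vector \<Rightarrow> real) \<Rightarrow> bool" where
  "strongly_convex h \<longleftrightarrow> (\<exists>\<mu>>0. \<forall>x y. \<forall>t\<in>{0..1}.
     h (t *\<^sub>R x + (1 - t) *\<^sub>R y)
       \<le> t * h x + (1 - t) * h y - \<mu> / 2 * t * (1 - t) * (norm (x - y))\<^sup>2)"

(* Attainment of each minimum is part of the condition: otherwise min_value would be
   meaningless for an empty solution set. *)
definition holder_error_bound ::
    "('a::real_normed_vector \<Rightarrow> real) \<Rightarrow> 'a set \<Rightarrow> real \<Rightarrow> bool" where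
  "holder_error_bound h S \<theta> \<longleftrightarrow> min_attained h S \<and>
     (\<exists>c>0. \<forall>x\<in>S.
        min_attained (\<lambda>w. norm (x - w)) (argmin_set h S) \<and>
        min_value (\<lambda>w. norm (x - w)) (argmin_set h S)
          \<le> c * (h x - min_value h S) powr \<theta>)"

end

theory Submission
  imports Defs
begin

text \<open>Write \<open>\<Omega> = {x. g x \<le> r}\<close>, let \<open>\<mu>\<close> be the modulus of strong convexity of \<open>g\<close>, \<open>m\<close> the minimum
of \<open>f\<close> on \<open>\<Omega>\<close>, and \<open>z\<close> an unconstrained minimiser, so that \<open>f z < m\<close> and therefore \<open>g z > r\<close>.

The proof compares \<open>f\<close> at two feasible points with \<open>f\<close> at one well-chosen third feasible point, and
needs no multipliers. If \<open>x\<close> and \<open>y\<close> lie in \<open>\<Omega>\<close> at distance \<open>d\<close>, strong convexity leaves the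
slack \<open>q = \<mu> d\<^sup>2 / 8\<close> in the constraint at their midpoint. This slack pays for a step of relative
length \<open>q / (q + g z - r)\<close> from the midpoint towards \<open>z\<close>, along which \<open>f\<close> drops at a rate governed
by \<open>m - f z > 0\<close>. The end of the step is still feasible, so \<open>f\<close> is at least \<open>m\<close> there; convexity of
\<open>f\<close> turns this into \<open>\<mu> (m - f z) d\<^sup>2 \<le> 4 (g z - r) (f x + f y - 2 m)\<close>
(lemma \<open>sublevel_quadratic_growth\<close>).

Taking both points optimal shows that the constrained minimiser is unique; taking only \<open>y\<close> optimal
gives the error bound with exponent \<open>1/2\<close>. That a constrained minimiser exists at all follows from
compactness of \<open>\<Omega>\<close>: it is bounded because \<open>g\<close> is strongly convex and bounded below, and closed
bounded sets are compact in finite dimension (lemma \<open>compact_if_finite_span\<close>).\<close>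

section \<open>Compactness in finite-dimensional normed spaces\<close>

text \<open>The hypothesis makes \<open>span B\<close> closed, so a new vector \<open>b\<close> has a positive distance from it, of
which \<open>\<delta>\<close> is a lower bound. The coefficient of \<open>b\<close> in a vector of norm at most \<open>R\<close> is then at most
\<open>R / \<delta>\<close> in absolute value, and the vector lies in the continuous image of a compact product.\<close>

lemma compact_cball_Int_span_insert:
  fixes B :: "'a::real_normed_vector set"
  assumes compact_B: "\<And>R. compact (cball 0 R \<inter> span B)"
  shows "compact (cball 0 R \<inter> span (insert b B))"
proof (cases "b \<in> span B")
  case True
  then show ?thesis
    using compact_B by (simp add: span_redundant)
next
  case False
  let ?K = "cball 0 (norm b + 1) \<inter> span B"
  have "closed ?K" "b \<notin> ?K"
    using compact_B compact_imp_closed False by blast+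
  then obtain e where e: "e > 0" "\<And>v. dist v b < e \<Longrightarrow> v \<notin> ?K"
    by (metis open_Compl open_dist ComplD ComplI)
  define \<delta> where "\<delta> = min e 1"
  have "\<delta> > 0"
    using e by (simp add: \<delta>_def)
  have dist_b: "\<delta> \<le> norm (v - b)" if "v \<in> span B" for v
  proof (rule ccontr)
    assume far: "\<not> \<delta> \<le> norm (v - b)"
    then have "dist v b < e" "norm (v - b) < 1"
      by (auto simp: \<delta>_def dist_norm)
    moreover have "norm v \<le> norm b + norm (v - b)"
      using norm_triangle_ineq[of b "v - b"] by simp
    ultimately show False
      using e(2)[of v] that by simp
  qed
  have coeff_bound: "\<bar>t\<bar> * \<delta> \<le> norm (v + t *\<^sub>R b)" if "v \<in> span B" for v t
  proof (cases "t = 0")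
    case False
    have "v + t *\<^sub>R b = (- t) *\<^sub>R ((- 1 / t) *\<^sub>R v - b)"
      using False by (simp add: scaleR_right_diff_distrib)
    then have "norm (v + t *\<^sub>R b) = \<bar>t\<bar> * norm ((- 1 / t) *\<^sub>R v - b)"
      by (metis norm_scaleR abs_minus_cancel)
    then show ?thesis
      using dist_b[of "(- 1 / t) *\<^sub>R v"] that by (simp add: span_scale span_neg mult_left_mono)
  qed simp
  define T where "T = R / \<delta>"
  define C where "C = (\<lambda>(t, v). v + t *\<^sub>R b) ` ({-T..T} \<times> (cball 0 (R + T * norm b) \<inter> span B))"
  have "compact C"
    unfolding C_def
    by (intro compact_continuous_image compact_Times compact_B compact_Icc)
      (auto simp: case_prod_unfold intro!: continuous_intros)
  have "C \<subseteq> span (insert b B)"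
  proof -
    have "v + t *\<^sub>R b \<in> span (insert b B)" if "v \<in> span B" for v t
      using that by (intro span_add span_scale span_base[of b])
        (auto intro: span_mono[THEN subsetD, of B])
    then show ?thesis
      by (auto simp: C_def)
  qed
  moreover have "cball 0 R \<inter> span (insert b B) \<subseteq> C"
  proof
    fix x assume x: "x \<in> cball 0 R \<inter> span (insert b B)"
    then obtain t where t: "x - t *\<^sub>R b \<in> span B"
      using span_breakdown_eq by blast
    have "\<bar>t\<bar> * \<delta> \<le> R"
      using coeff_bound[OF t, of t] x by simp
    then have T: "\<bar>t\<bar> \<le> T"
      using \<open>\<delta> > 0\<close> by (simp add: T_def field_simps)
    have "norm (x - t *\<^sub>R b) \<le> norm x + \<bar>t\<bar> * norm b"
      using norm_triangle_ineq4[of x "t *\<^sub>R b"] by simp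
    also have "\<dots> \<le> R + T * norm b"
      using x T by (intro add_mono mult_right_mono) auto
    finally show "x \<in> C"
      unfolding C_def using t T by (intro image_eqI[of _ _ "(t, x - t *\<^sub>R b)"]) auto
  qed
  ultimately have "cball 0 R \<inter> span (insert b B) = cball 0 R \<inter> C"
    by blast
  then show ?thesis
    using \<open>compact C\<close> by (simp add: closed_Int_compact)
qed

lemma compact_cball_Int_span:
  fixes B :: "'a::real_normed_vector set"
  assumes "finite B"
  shows "compact (cball 0 R \<inter> span B)"
  using assms
proof (induction B arbitrary: R)
  case empty
  have "cball 0 R \<inter> span {} \<subseteq> {0::'a}"
    by auto
  then show ?case
    by (meson finite.emptyI finite.insertI finite_subset finite_imp_compact)
next
  case (insert b B)
  then show ?case
    by (intro compact_cball_Int_span_insert)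
qed

lemma compact_if_finite_span:
  fixes B S :: "'a::real_normed_vector set"
  assumes "finite B" "span B = UNIV" "closed S" "bounded S"
  shows "compact S"
proof -
  obtain R where "S \<subseteq> cball 0 R"
    using \<open>bounded S\<close> unfolding bounded_iff by (meson mem_cball_0 subsetI)
  then have "S = S \<inter> (cball 0 R \<inter> span B)"
    using assms by auto
  then show ?thesis
    using compact_cball_Int_span[OF \<open>finite B\<close>, of R] \<open>closed S\<close>
    by (metis closed_Int_compact)
qed

section \<open>Smooth functions and minima\<close>

lemma smooth_fun_continuous_on:
  assumes "smooth_fun h"
  shows "continuous_on S h"
  using assms unfolding smooth_fun_def
  by (meson continuous_at_imp_continuous_on has_derivative_continuous)

lemma argmin_set_iff:
  "x \<in> argmin_set h S \<longleftrightarrow> x \<in> S \<and> (\<forall>y\<in>S. h x \<le> h y)"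
  by (auto simp: argmin_set_def is_arg_min_linorder)

lemma min_value_eq:
  assumes "x \<in> argmin_set h S"
  shows "min_value h S = h x"
  unfolding min_value_def using assms
  by (intro Least_equality) (auto simp: argmin_set_iff)

section \<open>Sublevel sets of strongly convex functions\<close>

definition strongly_convex_with :: "real \<Rightarrow> ('a::real_normed_vector \<Rightarrow> real) \<Rightarrow> bool" where
  "strongly_convex_with \<mu> h \<longleftrightarrow> (\<forall>x y. \<forall>t\<in>{0..1}.
     h (t *\<^sub>R x + (1 - t) *\<^sub>R y)
       \<le> t * h x + (1 - t) * h y - \<mu> / 2 * t * (1 - t) * (norm (x - y))\<^sup>2)"

lemma strongly_convex_with_midpoint:
  assumes "strongly_convex_with \<mu> h"
  shows "h (midpoint x y) \<le> (h x + h y) / 2 - \<mu> * (norm (x - y))\<^sup>2 / 8"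
proof -
  have "h ((1/2) *\<^sub>R x + (1 - 1/2) *\<^sub>R y)
      \<le> (1/2) * h x + (1 - 1/2) * h y - \<mu> / 2 * (1/2) * (1 - 1/2) * (norm (x - y))\<^sup>2"
    using assms unfolding strongly_convex_with_def
    by (elim allE[of _ x] allE[of _ y] ballE[of _ _ "1/2"]) auto
  then show ?thesis
    by (simp add: midpoint_def scaleR_right_distrib field_simps)
qed

lemma strongly_convex_with_imp_convex_on:
  assumes "strongly_convex_with \<mu> h" "\<mu> \<ge> 0"
  shows "convex_on UNIV h"
proof (rule convex_onI)
  fix t :: real and x y assume t: "0 < t" "t < 1"
  have "h ((1 - t) *\<^sub>R x + (1 - (1 - t)) *\<^sub>R y) \<le> (1 - t) * h x + (1 - (1 - t)) * h y
      - \<mu> / 2 * (1 - t) * (1 - (1 - t)) * (norm (x - y))\<^sup>2"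
    using assms t unfolding strongly_convex_with_def
    by (elim allE[of _ x] allE[of _ y] ballE[of _ _ "1 - t"]) auto
  moreover have "0 \<le> \<mu> / 2 * (1 - t) * (1 - (1 - t)) * (norm (x - y))\<^sup>2"
    using t \<open>\<mu> \<ge> 0\<close> by simp
  ultimately show "h ((1 - t) *\<^sub>R x + t *\<^sub>R y) \<le> (1 - t) * h x + t * h y"
    by simp
qed simp

text \<open>The midpoint of two points of the sublevel set has value at most \<open>r - \<mu> d\<^sup>2 / 8\<close>; a lower
bound on the function therefore bounds \<open>d\<close>.\<close>

lemma bounded_sublevel_strongly_convex:
  assumes g: "strongly_convex_with \<mu> g" "\<mu> > 0"
    and lower: "\<And>x. l \<le> g x"
  shows "bounded {x. g x \<le> r}"
proof (cases "{x. g x \<le> r} = {}")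
  case False
  then obtain a where a: "g a \<le> r"
    by blast
  have "dist a x \<le> sqrt (8 * (r - l) / \<mu>)" if "g x \<le> r" for x
  proof (rule real_le_rsqrt)
    have "\<mu> * (norm (a - x))\<^sup>2 \<le> 8 * (r - l)"
      using strongly_convex_with_midpoint[OF g(1), of a x] lower[of "midpoint a x"] a that
      by argo
    then show "(dist a x)\<^sup>2 \<le> 8 * (r - l) / \<mu>"
      using \<open>\<mu> > 0\<close> by (simp add: dist_norm field_simps)
  qed
  then show ?thesis
    by (auto simp: bounded_def)
qed simp

text \<open>The slack of the constraint at the midpoint is traded for a decrease of \<open>f\<close> by stepping
towards the infeasible point \<open>z\<close>.\<close>

lemma sublevel_quadratic_growth:
  fixes f g :: "'a::real_normed_vector \<Rightarrow> real"
  assumes f: "convex_on UNIV f"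
    and g: "strongly_convex_with \<mu> g" "\<mu> \<ge> 0"
    and lower: "\<And>w. g w \<le> r \<Longrightarrow> m \<le> f w"
    and z: "f z < m"
    and x: "g x \<le> r" and y: "g y \<le> r"
  shows "\<mu> * (m - f z) * (norm (x - y))\<^sup>2 \<le> 4 * (g z - r) * (f x + f y - 2 * m)"
proof -
  define p where "p = midpoint x y"
  define q where "q = \<mu> * (norm (x - y))\<^sup>2 / 8"
  define h where "h = g z - r"
  have "h > 0"
    using lower[of z] z by (force simp: h_def)
  have "q \<ge> 0"
    using \<open>\<mu> \<ge> 0\<close> by (simp add: q_def)
  have gp: "g p \<le> r - q"
    using strongly_convex_with_midpoint[OF g(1), of x y] x y unfolding p_def q_def by argo
  have fp: "f p \<le> (f x + f y) / 2"
    using convex_onD[OF f, of "1/2" x y]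
    by (simp add: p_def midpoint_def scaleR_right_distrib field_simps)
  \<comment> \<open>The longest step for which convexity of \<open>g\<close> still guarantees feasibility.\<close>
  define s where "s = q / (h + q)"
  define w where "w = (1 - s) *\<^sub>R p + s *\<^sub>R z"
  have s: "0 \<le> s" "s \<le> 1" "s * (h + q) = q" "(1 - s) * (h + q) = h"
    using \<open>h > 0\<close> \<open>q \<ge> 0\<close> by (auto simp: s_def field_simps)
  have "g w \<le> (1 - s) * g p + s * g z"
    using convex_onD[OF strongly_convex_with_imp_convex_on[OF g], of s p z] s by (simp add: w_def)
  also have "\<dots> \<le> (1 - s) * (r - q) + s * (r + h)"
    using gp s by (intro add_mono mult_left_mono) (auto simp: h_def)
  also have "\<dots> = r"
    using s(3) by (simp add: algebra_simps)
  finally have "m \<le> f w"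
    by (rule lower)
  also have "f w \<le> (1 - s) * f p + s * f z"
    using convex_onD[OF f, of s p z] s by (simp add: w_def)
  finally have "m * (h + q) \<le> ((1 - s) * f p + s * f z) * (h + q)"
    using \<open>h > 0\<close> \<open>q \<ge> 0\<close> by (intro mult_right_mono) auto
  also have "\<dots> = ((1 - s) * (h + q)) * f p + (s * (h + q)) * f z"
    by (simp add: algebra_simps)
  also have "\<dots> = h * f p + q * f z"
    using s by simp
  finally have "q * (m - f z) \<le> h * (f p - m)"
    by (simp add: algebra_simps)
  also have "\<dots> \<le> h * ((f x + f y) / 2 - m)"
    using fp \<open>h > 0\<close> by (intro mult_left_mono) auto
  finally show ?thesis
    by (simp add: q_def h_def field_simps)
qed

section \<open>The error bound\<close>

theorem lemma5:
  fixes f g :: "'a::real_normed_vector \<Rightarrow> real" and r :: real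
  assumes fin_dim: "\<exists>B::'a set. finite B \<and> span B = UNIV"
    and f_convex: "convex_on UNIV f"
    and f_smooth: "smooth_fun f"
    and g_nonneg: "\<And>x. 0 \<le> g x"
    and g_strongly_convex: "strongly_convex g"
    and g_smooth: "smooth_fun g"
    and f_min: "min_attained f UNIV"
    and min_less: "min_value f UNIV < min_value f {x. g x \<le> r}"
    and slater: "\<exists>x0. g x0 < r"
  shows "holder_error_bound f {x. g x \<le> r} (1 / 2)"
proof -
  let ?\<Omega> = "{x. g x \<le> r}"
  obtain \<mu> where "\<mu> > 0" and g: "strongly_convex_with \<mu> g"
    using g_strongly_convex unfolding strongly_convex_def strongly_convex_with_def by blast
  obtain z where z: "z \<in> argmin_set f UNIV"
    using f_min by (auto simp: min_attained_def)

  have "closed ?\<Omega>"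
    using smooth_fun_continuous_on[OF g_smooth] by (intro closed_Collect_le) auto
  moreover have "bounded ?\<Omega>"
    using bounded_sublevel_strongly_convex[OF g \<open>\<mu> > 0\<close> g_nonneg] .
  ultimately have "compact ?\<Omega>"
    using fin_dim compact_if_finite_span by blast
  moreover have "?\<Omega> \<noteq> {}"
    using slater by (auto intro: less_imp_le)
  ultimately obtain a where a: "a \<in> argmin_set f ?\<Omega>"
    using continuous_attains_inf[OF _ _ smooth_fun_continuous_on[OF f_smooth], of ?\<Omega>]
    by (auto simp: argmin_set_iff)
  then have a_feasible: "g a \<le> r" and a_min: "\<And>w. g w \<le> r \<Longrightarrow> f a \<le> f w"
    by (auto simp: argmin_set_iff)
  have gap: "f z < f a"
    using min_less min_value_eq[OF z] min_value_eq[OF a] by simp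
  have "g z > r"
    using a_min[of z] gap by force

  define C where "C = 4 * (g z - r) / (\<mu> * (f a - f z))"
  have "C > 0"
    using \<open>g z > r\<close> gap \<open>\<mu> > 0\<close> by (simp add: C_def)
  have growth: "(norm (x - a))\<^sup>2 \<le> C * (f x - f a)" if "g x \<le> r" for x
    using sublevel_quadratic_growth[OF f_convex g _ a_min gap that a_feasible] gap \<open>\<mu> > 0\<close>
    by (simp add: C_def field_simps)

  have unique: "argmin_set f ?\<Omega> = {a}"
  proof -
    have "x = a" if "x \<in> argmin_set f ?\<Omega>" for x
    proof -
      have "g x \<le> r" "f x \<le> f a"
        using that a_feasible by (auto simp: argmin_set_iff)
      then have "C * (f x - f a) \<le> 0"
        using \<open>C > 0\<close> by (simp add: mult_le_0_iff)
      then have "(norm (x - a))\<^sup>2 \<le> 0"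
        using growth[OF \<open>g x \<le> r\<close>] by linarith
      then show ?thesis
        by simp
    qed
    then show ?thesis
      using a by blast
  qed

  have "min_attained (\<lambda>w. norm (x - w)) (argmin_set f ?\<Omega>) \<and>
      min_value (\<lambda>w. norm (x - w)) (argmin_set f ?\<Omega>)
        \<le> sqrt C * (f x - min_value f ?\<Omega>) powr (1 / 2)" if x: "x \<in> ?\<Omega>" for x
  proof -
    have nearest: "a \<in> argmin_set (\<lambda>w. norm (x - w)) (argmin_set f ?\<Omega>)"
      unfolding unique by (simp add: argmin_set_iff)
    have "norm (x - a) \<le> sqrt (C * (f x - f a))"
      using growth x by (intro real_le_rsqrt) auto
    also have "\<dots> = sqrt C * (f x - f a) powr (1 / 2)"
      using a_min[of x] x by (simp add: real_sqrt_mult powr_half_sqrt)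
    finally show ?thesis
      using nearest min_value_eq[OF nearest] min_value_eq[OF a]
      by (auto simp: min_attained_def)
  qed
  then show ?thesis
    unfolding holder_error_bound_def using a \<open>C > 0\<close>
    by (intro conjI exI[of _ "sqrt C"]) (auto simp: min_attained_def)
qed

end
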